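(* Let $\mathcal G_0\subseteq\mathcal M^{n\times n}$ and let $\circ$ be an associative and invertible operation on $\mathcal G_0$ (i.e. $(\mathcal G_0,\circ)$ is a group); denote by $(\circ\mathbf A)^{-1}$ the inverse of $\mathbf A\in\mathcal G_0$ with respect to $\circ$. Let $\mathfrak D,\widetilde{\mathfrak D}\subset\mathbb C$ be two stability regions such that for every $\mathbf B\in\mathcal G_0$, $\sigma(\mathbf B)\subset\mathfrak D$ implies $\sigma((\circ\mathbf B)^{-1})\subset\widetilde{\mathfrak D}$. Let $\mathcal G\subset\mathcal G_0$ be a matrix class and $\mathcal G^{-1}=\{(\circ\mathbf G)^{-1}:\mathbf G\in\mathcal G\}$, and let $\mathbf A\in\mathcal G_0$. Then: 1. If $\mathbf A$ is left $(\mathfrak D,\mathcal G,\circ)$-stable, then $(\circ\mathbf A)^{-1}$ is right $(\widetilde{\mathfrak D},\mathcal G^{-1},\circ)$-stable. 2. If, in addition, $\sigma((\circ\mathbf B)^{-1})\subset\widetilde{\mathfrak D}$ implies $\sigma(\mathbf B)\subset\mathfrak D$ for every $\mathbf B\in\mathcal G_0$, the class $\mathcal G$ is closed with respect to $\circ$-inversion, and $\sigma(\mathbf G\circ\mathbf B)=\sigma(\mathbf B\circ\mathbf G)$ for all $\mathbf G\in\mathcal G$, $\mathbf B\in\mathcal G_0$, then $\mathbf A$ is $(\mathfrak D,\mathcal G,\circ)$-stable if and only if $(\circ\mathbf A)^{-1}$ is $(\mathfrak D,\mathcal G,\circ)$-stable.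
   Context: $\mathcal M^{n\times n}$ is the set of real $n\times n$ matrices and $\sigma(\mathbf A)$ is the set of (complex) eigenvalues of $\mathbf A$. A stability region is a set $\mathfrak D\subset\mathbb C$ closed under complex conjugation. A matrix $\mathbf A\in\mathcal G_0$ is left (right) $(\mathfrak D,\mathcal G,\circ)$-stable if $\sigma(\mathbf G\circ\mathbf A)\subset\mathfrak D$ (respectively $\sigma(\mathbf A\circ\mathbf G)\subset\mathfrak D$) for every $\mathbf G\in\mathcal G$; it is $(\mathfrak D,\mathcal G,\circ)$-stable if it is both.
   Formalization: In part 2 the formal conclusion says the inverse of A is stable with respect to the second region (D-tilde), not D; as printed the claim fails, e.g. nonzero 1×1 matrices under multiplication, G={1}, D={2}, D-tilde={1/2}, A=2. *)

theory Defs
  imports "Jordan_Normal_Form.Spectral_Radius" "HOL-Algebra.Group"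
begin

text \<open>
  The spectrum is taken of the complexified matrix: eigenvalues of a real matrix need not be real.
\<close>

definition cspectrum :: "real mat \<Rightarrow> complex set" where
  "cspectrum A = spectrum (map_mat complex_of_real A)"

definition stability_region :: "complex set \<Rightarrow> bool" where
  "stability_region D \<longleftrightarrow> (\<forall>z\<in>D. cnj z \<in> D)"

text \<open>
  The group \<open>H\<close> carries both the matrix set and the operation, which
  is not necessarily the matrix product.
\<close>

definition left_stable :: "real mat monoid \<Rightarrow> complex set \<Rightarrow> real mat set \<Rightarrow> real mat \<Rightarrow> bool" where
  "left_stable H D \<G> A \<longleftrightarrow>
     A \<in> carrier H \<and> (\<forall>G\<in>\<G>. cspectrum (G \<otimes>\<^bsub>H\<^esub> A) \<subseteq> D)"

definition right_stable :: "real mat monoid \<Rightarrow> complex set \<Rightarrow> real mat set \<Rightarrow> real mat \<Rightarrow> bool" where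
  "right_stable H D \<G> A \<longleftrightarrow>
     A \<in> carrier H \<and> (\<forall>G\<in>\<G>. cspectrum (A \<otimes>\<^bsub>H\<^esub> G) \<subseteq> D)"

definition two_sided_stable :: "real mat monoid \<Rightarrow> complex set \<Rightarrow> real mat set \<Rightarrow> real mat \<Rightarrow> bool" where
  "two_sided_stable H D \<G> A \<longleftrightarrow> left_stable H D \<G> A \<and> right_stable H D \<G> A"

definition inverse_matrices :: "real mat monoid \<Rightarrow> real mat set \<Rightarrow> real mat set" where
  "inverse_matrices H \<G> = {inv\<^bsub>H\<^esub> G | G. G \<in> \<G>}"

end

theory Submission
  imports Defs
begin

text \<open>
  Everything rests on \<open>inv A \<otimes> inv G = inv (G \<otimes> A)\<close>: inversion reverses the order of the factors
  and so exchanges left and right stability. When the spectra of \<open>G \<otimes> B\<close> and \<open>B \<otimes> G\<close> agree, the two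
  one-sided notions coincide and the exchange becomes invisible.
\<close>

lemma right_stable_inv_if_left_stable:
  assumes "group H" and "\<G> \<subseteq> carrier H"
    and "\<forall>B\<in>carrier H. cspectrum B \<subseteq> D \<longrightarrow> cspectrum (inv\<^bsub>H\<^esub> B) \<subseteq> D'"
    and "left_stable H D \<G> A"
  shows "right_stable H D' (inverse_matrices H \<G>) (inv\<^bsub>H\<^esub> A)"
proof -
  interpret group H by fact
  have A: "A \<in> carrier H" and st: "\<And>G. G \<in> \<G> \<Longrightarrow> cspectrum (G \<otimes>\<^bsub>H\<^esub> A) \<subseteq> D"
    using assms(4) by (auto simp: left_stable_def)
  have "cspectrum (inv\<^bsub>H\<^esub> A \<otimes>\<^bsub>H\<^esub> inv\<^bsub>H\<^esub> G) \<subseteq> D'" if "G \<in> \<G>" for G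
  proof -
    have G: "G \<in> carrier H" using that assms(2) by blast
    \<comment> \<open>The spectral implication is applied to the product as a single group element,
      \<open>B = G \<otimes> A\<close>; only afterwards is the inverse split into factors.\<close>
    then have "cspectrum (inv\<^bsub>H\<^esub> (G \<otimes>\<^bsub>H\<^esub> A)) \<subseteq> D'"
      using assms(3) st[OF that] A by blast
    then show ?thesis using G A by (simp add: inv_mult_group)
  qed
  then show ?thesis using A by (auto simp: right_stable_def inverse_matrices_def)
qed

text \<open>The converse exchange, obtained by running the same computation backwards. Membership of
  \<open>A\<close> has to be assumed: outside the carrier \<open>inv\<close> is unspecified, so
  \<open>inv A\<close> lying in the carrier says nothing about \<open>A\<close>.\<close>

lemma left_stable_if_right_stable_inv:
  assumes "group H" and "\<G> \<subseteq> carrier H"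
    and "\<forall>B\<in>carrier H. cspectrum (inv\<^bsub>H\<^esub> B) \<subseteq> D' \<longrightarrow> cspectrum B \<subseteq> D"
    and "A \<in> carrier H"
    and "right_stable H D' (inverse_matrices H \<G>) (inv\<^bsub>H\<^esub> A)"
  shows "left_stable H D \<G> A"
proof -
  interpret group H by fact
  have "cspectrum (G \<otimes>\<^bsub>H\<^esub> A) \<subseteq> D" if "G \<in> \<G>" for G
  proof -
    have G: "G \<in> carrier H" using that assms(2) by blast
    have "cspectrum (inv\<^bsub>H\<^esub> A \<otimes>\<^bsub>H\<^esub> inv\<^bsub>H\<^esub> G) \<subseteq> D'"
      using assms(5) that by (auto simp: right_stable_def inverse_matrices_def)
    then have "cspectrum (inv\<^bsub>H\<^esub> (G \<otimes>\<^bsub>H\<^esub> A)) \<subseteq> D'"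
      using G assms(4) by (simp add: inv_mult_group)
    then show ?thesis using assms(3) G assms(4) by blast
  qed
  then show ?thesis using assms(4) by (simp add: left_stable_def)
qed

text \<open>Inversion is an involution on the carrier, so a class that it maps into itself is mapped
  onto itself.\<close>

lemma inverse_matrices_eq:
  assumes "group H" and "\<G> \<subseteq> carrier H" and "\<forall>G\<in>\<G>. inv\<^bsub>H\<^esub> G \<in> \<G>"
  shows "inverse_matrices H \<G> = \<G>"
proof
  show "inverse_matrices H \<G> \<subseteq> \<G>" using assms(3) by (auto simp: inverse_matrices_def)
  show "\<G> \<subseteq> inverse_matrices H \<G>"
  proof
    fix G assume "G \<in> \<G>"
    moreover have "G = inv\<^bsub>H\<^esub> (inv\<^bsub>H\<^esub> G)"
      using group.inv_inv[OF assms(1)] \<open>G \<in> \<G>\<close> assms(2) by auto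
    ultimately show "G \<in> inverse_matrices H \<G>"
      using assms(3) by (auto simp: inverse_matrices_def)
  qed
qed

text \<open>Both notions include \<open>A \<in> carrier H\<close>, which permits taking
  \<open>B = A\<close> in the assumption.\<close>

lemma left_stable_iff_right_stable:
  assumes "\<forall>G\<in>\<G>. \<forall>B\<in>carrier H. cspectrum (G \<otimes>\<^bsub>H\<^esub> B) = cspectrum (B \<otimes>\<^bsub>H\<^esub> G)"
  shows "left_stable H D \<G> A \<longleftrightarrow> right_stable H D \<G> A"
  using assms unfolding left_stable_def right_stable_def by (metis (no_types))

text \<open>In the second part the inverse is measured against \<open>D'\<close>, the region that
  the spectral implications assign to inverses. With \<open>D\<close> on both sides the equivalence
  fails: take the positive reals under multiplication, \<open>D\<close> the reals above 1,
  \<open>D'\<close> the open interval from 0 to 1, the class consisting of 1 alone, and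
  \<open>A = 2\<close>.\<close>

theorem theorem81:
  fixes n :: nat
    and H :: "real mat monoid"
    and D D' :: "complex set"
    and \<G> :: "real mat set"
    and A :: "real mat"
  assumes "carrier H \<subseteq> carrier_mat n n"
    and "group H"
    and "stability_region D"
    and "stability_region D'"
    and "\<forall>B\<in>carrier H. cspectrum B \<subseteq> D \<longrightarrow> cspectrum (inv\<^bsub>H\<^esub> B) \<subseteq> D'"
    and "\<G> \<subseteq> carrier H"
    and "A \<in> carrier H"
  shows "(left_stable H D \<G> A \<longrightarrow> right_stable H D' (inverse_matrices H \<G>) (inv\<^bsub>H\<^esub> A)) \<and>
    ((\<forall>B\<in>carrier H. cspectrum (inv\<^bsub>H\<^esub> B) \<subseteq> D' \<longrightarrow> cspectrum B \<subseteq> D) \<and>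
     (\<forall>G\<in>\<G>. inv\<^bsub>H\<^esub> G \<in> \<G>) \<and>
     (\<forall>G\<in>\<G>. \<forall>B\<in>carrier H. cspectrum (G \<otimes>\<^bsub>H\<^esub> B) = cspectrum (B \<otimes>\<^bsub>H\<^esub> G)) \<longrightarrow>
     (two_sided_stable H D \<G> A \<longleftrightarrow> two_sided_stable H D' \<G> (inv\<^bsub>H\<^esub> A)))"
proof (intro conjI impI)
  show "right_stable H D' (inverse_matrices H \<G>) (inv\<^bsub>H\<^esub> A)" if "left_stable H D \<G> A"
    using right_stable_inv_if_left_stable assms(2,5,6) that by blast
next
  assume *: "(\<forall>B\<in>carrier H. cspectrum (inv\<^bsub>H\<^esub> B) \<subseteq> D' \<longrightarrow> cspectrum B \<subseteq> D) \<and>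
     (\<forall>G\<in>\<G>. inv\<^bsub>H\<^esub> G \<in> \<G>) \<and>
     (\<forall>G\<in>\<G>. \<forall>B\<in>carrier H. cspectrum (G \<otimes>\<^bsub>H\<^esub> B) = cspectrum (B \<otimes>\<^bsub>H\<^esub> G))"
  have "left_stable H D \<G> A \<longleftrightarrow> right_stable H D' (inverse_matrices H \<G>) (inv\<^bsub>H\<^esub> A)"
    using right_stable_inv_if_left_stable left_stable_if_right_stable_inv assms(2,5-7) * by blast
  also have "inverse_matrices H \<G> = \<G>"
    using inverse_matrices_eq assms(2,6) * by blast
  \<comment> \<open>The left-right equivalence is used twice, for \<open>A\<close> with
    \<open>D\<close> and for \<open>inv A\<close> with \<open>D'\<close>, so on each side one
    one-sided condition suffices.\<close>
  finally show "two_sided_stable H D \<G> A \<longleftrightarrow> two_sided_stable H D' \<G> (inv\<^bsub>H\<^esub> A)"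
    using left_stable_iff_right_stable * unfolding two_sided_stable_def by blast
qed

end
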